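(* The quintuple $(H_{\rm RT}(X,\Omega),\,m_{\rm RT},\,1,\,\Delta_{\rm RT},\,\varepsilon_{\rm RT})$ is a unitary bialgebra over $\mathbf{k}$.
   Context: Let $\mathbf{k}$ be a unitary commutative ring, $X$ a set, $\Omega$ a nonempty set disjoint from $X$, and fix maps $\mu:X\to\mathbf{k}$, $x\mapsto\mu_x$, and $\lambda:\Omega\to\mathbf{k}$, $\omega\mapsto\lambda_\omega$. Decorated forests. An $(X,\Omega)$-decorated rooted tree is a (nonempty) planar rooted tree whose internal (non-leaf) vertices are decorated by elements of $\Omega$ and whose leaf vertices are decorated by elements of $X\sqcup\Omega$; the only vertex of a one-vertex tree is regarded as a leaf. $\mathcal{T}_{\rm RT}(X,\Omega)$ is the set of such trees, and $\mathcal{F}_{\rm RT}(X,\Omega)$ (the forests) is the free monoid on $\mathcal{T}_{\rm RT}(X,\Omega)$ under concatenation, with unit the empty forest $1$. $H_{\rm RT}(X,\Omega)=\mathbf{k}\mathcal{F}_{\rm RT}(X,\Omega)$ is the free $\mathbf{k}$-module on the forests, a unitary associative algebra under the concatenation product $m_{\rm RT}$. For $a\in X\sqcup\Omega$, $\bullet_a$ is the one-vertex tree decorated by $a$. For $\omega\in\Omega$, $B^+_\omega:H_{\rm RT}(X,\Omega)\to H_{\rm RT}(X,\Omega)$ is the linear grafting operator: $B^+_\omega(1)=\bullet_\omega$, and $B^+_\omega(T_1\cdots T_n)$ is the tree obtained by joining the roots of $T_1,\dots,T_n$ (in order) to a new root decorated by $\omega$. Every tree is uniquely either $\bullet_x$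 with $x\in X$ or $B^+_\omega(\overline{F})$ with $\omega\in\Omega$, $\overline{F}$ a forest. Coproduct. The linear map $\Delta_{\rm RT}:H_{\rm RT}(X,\Omega)\to H_{\rm RT}(X,\Omega)\otimes H_{\rm RT}(X,\Omega)$ is defined recursively by $\Delta_{\rm RT}(1)=1\otimes 1$; $\Delta_{\rm RT}(\bullet_x)=\bullet_x\otimes 1+1\otimes\bullet_x+\mu_x\,1\otimes 1$ for $x\in X$; $\Delta_{\rm RT}(B^+_\omega(\overline{F}))=B^+_\omega(\overline{F})\otimes 1+(\mathrm{id}\otimes B^+_\omega)\Delta_{\rm RT}(\overline{F})+\lambda_\omega\overline{F}\otimes 1$; and $\Delta_{\rm RT}(T_1\cdots T_m)=\Delta_{\rm RT}(T_1)\cdots\Delta_{\rm RT}(T_m)$ for $m\ge 2$ trees. Counit. The linear map $\varepsilon_{\rm RT}:H_{\rm RT}(X,\Omega)\to\mathbf{k}$ is defined recursively by $\varepsilon_{\rm RT}(1)=1_{\mathbf{k}}$; $\varepsilon_{\rm RT}(\bullet_x)=-\mu_x$ for $x\in X$; $\varepsilon_{\rm RT}(B^+_\omega(\overline{F}))=-\lambda_\omega\varepsilon_{\rm RT}(\overline{F})$; and $\varepsilon_{\rm RT}(T_1\cdots T_m)=\varepsilon_{\rm RT}(T_1)\cdots\varepsilon_{\rm RT}(T_m)$ for $m\ge 2$ trees. *)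

theory Defs
  imports "HOL-Library.Poly_Mapping"
begin

section \<open>Modules and linear maps\<close>

text \<open>
  The sort \<open>{comm_ring, comm_monoid_mult}\<close> is that of unital commutative rings in which
  \<open>0 = 1\<close> is allowed; it contains \<open>comm_ring_1\<close>. As the locale \<open>module\<close>
  of the library requires \<open>comm_ring_1\<close>, modules are axiomatised here.
\<close>

locale kmodule_on =
  fixes M :: "'v::ab_group_add set"
    and s :: "'k::{comm_ring,comm_monoid_mult} \<Rightarrow> 'v \<Rightarrow> 'v"
  assumes zero_mem: "0 \<in> M"
    and add_mem: "u \<in> M \<Longrightarrow> v \<in> M \<Longrightarrow> u + v \<in> M"
    and scale_mem: "u \<in> M \<Longrightarrow> s c u \<in> M"
    and scale_add_right: "u \<in> M \<Longrightarrow> v \<in> M \<Longrightarrow> s c (u + v) = s c u + s c v"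
    and scale_add_left: "u \<in> M \<Longrightarrow> s (c + d) u = s c u + s d u"
    and scale_scale: "u \<in> M \<Longrightarrow> s c (s d u) = s (c * d) u"
    and scale_one: "u \<in> M \<Longrightarrow> s 1 u = u"

definition linear_on ::
  "'u::ab_group_add set \<Rightarrow> ('k \<Rightarrow> 'u \<Rightarrow> 'u) \<Rightarrow> 'v::ab_group_add set \<Rightarrow> ('k \<Rightarrow> 'v \<Rightarrow> 'v)
    \<Rightarrow> ('u \<Rightarrow> 'v) \<Rightarrow> bool"
  where "linear_on M s N s' f \<longleftrightarrow>
    (\<forall>u\<in>M. f u \<in> N) \<and>
    (\<forall>u\<in>M. \<forall>v\<in>M. f (u + v) = f u + f v) \<and>
    (\<forall>c. \<forall>u\<in>M. f (s c u) = s' c (f u))"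

definition bilinear_on ::
  "'u::ab_group_add set \<Rightarrow> ('k \<Rightarrow> 'u \<Rightarrow> 'u) \<Rightarrow> 'v::ab_group_add set \<Rightarrow> ('k \<Rightarrow> 'v \<Rightarrow> 'v)
    \<Rightarrow> 'w::ab_group_add set \<Rightarrow> ('k \<Rightarrow> 'w \<Rightarrow> 'w) \<Rightarrow> ('u \<Rightarrow> 'v \<Rightarrow> 'w) \<Rightarrow> bool"
  where "bilinear_on M s N s' P s'' f \<longleftrightarrow>
    (\<forall>u\<in>M. linear_on N s' P s'' (f u)) \<and>
    (\<forall>v\<in>N. linear_on M s P s'' (\<lambda>u. f u v))"

section \<open>Free modules\<close>

text \<open>The free module on \<open>B\<close>: finitely supported functions with support in \<open>B\<close>.\<close>

definition free_module :: "'b set \<Rightarrow> ('b \<Rightarrow>\<^sub>0 'k::zero) set"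
  where "free_module B = {f. Poly_Mapping.keys f \<subseteq> B}"

definition basis :: "'b \<Rightarrow> ('b \<Rightarrow>\<^sub>0 'k::{comm_ring,comm_monoid_mult})"
  where "basis b = Poly_Mapping.single b 1"

definition scale :: "'k::{comm_ring,comm_monoid_mult} \<Rightarrow> ('b \<Rightarrow>\<^sub>0 'k) \<Rightarrow> ('b \<Rightarrow>\<^sub>0 'k)"
  where "scale c f = Poly_Mapping.map (\<lambda>x. c * x) f"

text \<open>
  The linear extension of a map \<open>g\<close> given on basis elements, with values in a module with
  scalar multiplication \<open>s\<close> (for values in the ground ring, \<open>s\<close> is \<open>(*)\<close>).
\<close>

definition lin_ext ::
  "('k::{comm_ring,comm_monoid_mult} \<Rightarrow> 'v \<Rightarrow> 'v) \<Rightarrow> ('b \<Rightarrow> 'v::ab_group_add) \<Rightarrow> ('b \<Rightarrow>\<^sub>0 'k) \<Rightarrow> 'v"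
  where "lin_ext s g f = (\<Sum>b\<in>Poly_Mapping.keys f. s (Poly_Mapping.lookup f b) (g b))"

definition bilin_ext ::
  "('k::{comm_ring,comm_monoid_mult} \<Rightarrow> 'v \<Rightarrow> 'v) \<Rightarrow> ('a \<Rightarrow> 'b \<Rightarrow> 'v::ab_group_add)
    \<Rightarrow> ('a \<Rightarrow>\<^sub>0 'k) \<Rightarrow> ('b \<Rightarrow>\<^sub>0 'k) \<Rightarrow> 'v"
  where "bilin_ext s g f h = lin_ext s (\<lambda>a. lin_ext s (g a) h) f"

section \<open>Tensor products of free modules\<close>

text \<open>
  The tensor product of the free modules on \<open>A\<close> and \<open>B\<close> is the free module on
  \<open>A \<times> B\<close>, where the basis element \<open>(a, b)\<close> is the tensor product of the basis
  elements \<open>a\<close> and \<open>b\<close>. Lemma \<open>tensor_universal\<close> below is its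
  universal property with respect to all modules.
\<close>

definition tensor ::
  "('a \<Rightarrow>\<^sub>0 'k::{comm_ring,comm_monoid_mult}) \<Rightarrow> ('b \<Rightarrow>\<^sub>0 'k) \<Rightarrow> ('a \<times> 'b \<Rightarrow>\<^sub>0 'k)"
    (infixl "\<otimes>\<^sub>k" 75)
  where "f \<otimes>\<^sub>k h = bilin_ext scale (\<lambda>a b. basis (a, b)) f h"

definition tensor_map ::
  "(('a \<Rightarrow>\<^sub>0 'k::{comm_ring,comm_monoid_mult}) \<Rightarrow> ('c \<Rightarrow>\<^sub>0 'k)) \<Rightarrow> (('b \<Rightarrow>\<^sub>0 'k) \<Rightarrow> ('d \<Rightarrow>\<^sub>0 'k))
    \<Rightarrow> ('a \<times> 'b \<Rightarrow>\<^sub>0 'k) \<Rightarrow> ('c \<times> 'd \<Rightarrow>\<^sub>0 'k)"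
  where "tensor_map \<phi> \<psi> = lin_ext scale (\<lambda>(a, b). \<phi> (basis a) \<otimes>\<^sub>k \<psi> (basis b))"

definition tensor_assoc ::
  "(('a \<times> 'b) \<times> 'c \<Rightarrow>\<^sub>0 'k::{comm_ring,comm_monoid_mult}) \<Rightarrow> ('a \<times> 'b \<times> 'c \<Rightarrow>\<^sub>0 'k)"
  where "tensor_assoc = lin_ext scale (\<lambda>((a, b), c). basis (a, (b, c)))"

text \<open>
  For a linear form \<open>\<epsilon>\<close>, the maps \<open>\<epsilon> \<otimes> id\<close> and \<open>id \<otimes> \<epsilon>\<close>
  followed by the canonical identifications of \<open>k \<otimes> H\<close> and \<open>H \<otimes> k\<close> with
  \<open>H\<close>.
\<close>

definition contract_left ::
  "(('a \<Rightarrow>\<^sub>0 'k::{comm_ring,comm_monoid_mult}) \<Rightarrow> 'k) \<Rightarrow> ('a \<times> 'b \<Rightarrow>\<^sub>0 'k) \<Rightarrow> ('b \<Rightarrow>\<^sub>0 'k)"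
  where "contract_left \<epsilon> = lin_ext scale (\<lambda>(a, b). scale (\<epsilon> (basis a)) (basis b))"

definition contract_right ::
  "(('b \<Rightarrow>\<^sub>0 'k::{comm_ring,comm_monoid_mult}) \<Rightarrow> 'k) \<Rightarrow> ('a \<times> 'b \<Rightarrow>\<^sub>0 'k) \<Rightarrow> ('a \<Rightarrow>\<^sub>0 'k)"
  where "contract_right \<epsilon> = lin_ext scale (\<lambda>(a, b). scale (\<epsilon> (basis b)) (basis a))"

text \<open>The product of \<open>H \<otimes> H\<close>: \<open>(a \<otimes> b) (c \<otimes> d) = a c \<otimes> b d\<close>.\<close>

definition tensor_mult ::
  "(('b \<Rightarrow>\<^sub>0 'k::{comm_ring,comm_monoid_mult}) \<Rightarrow> ('b \<Rightarrow>\<^sub>0 'k) \<Rightarrow> ('b \<Rightarrow>\<^sub>0 'k))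
    \<Rightarrow> ('b \<times> 'b \<Rightarrow>\<^sub>0 'k) \<Rightarrow> ('b \<times> 'b \<Rightarrow>\<^sub>0 'k) \<Rightarrow> ('b \<times> 'b \<Rightarrow>\<^sub>0 'k)"
  where "tensor_mult m = bilin_ext scale
    (\<lambda>(a, b) (c, d). m (basis a) (basis c) \<otimes>\<^sub>k m (basis b) (basis d))"

section \<open>Bialgebras with underlying free module\<close>

locale unital_algebra =
  fixes B :: "'b set"
    and m :: "('b \<Rightarrow>\<^sub>0 'k::{comm_ring,comm_monoid_mult}) \<Rightarrow> ('b \<Rightarrow>\<^sub>0 'k) \<Rightarrow> ('b \<Rightarrow>\<^sub>0 'k)"
    and u :: "'b \<Rightarrow>\<^sub>0 'k"
  assumes mult_bilinear:
      "bilinear_on (free_module B) scale (free_module B) scale (free_module B) scale m"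
    and unit_mem: "u \<in> free_module B"
    and mult_assoc: "\<lbrakk>x \<in> free_module B; y \<in> free_module B; z \<in> free_module B\<rbrakk>
      \<Longrightarrow> m (m x y) z = m x (m y z)"
    and unit_left: "x \<in> free_module B \<Longrightarrow> m u x = x"
    and unit_right: "x \<in> free_module B \<Longrightarrow> m x u = x"

locale counital_coalgebra =
  fixes B :: "'b set"
    and \<Delta> :: "('b \<Rightarrow>\<^sub>0 'k::{comm_ring,comm_monoid_mult}) \<Rightarrow> ('b \<times> 'b \<Rightarrow>\<^sub>0 'k)"
    and \<epsilon> :: "('b \<Rightarrow>\<^sub>0 'k) \<Rightarrow> 'k"
  assumes coproduct_linear: "linear_on (free_module B) scale (free_module (B \<times> B)) scale \<Delta>"
    and counit_linear: "linear_on (free_module B) scale UNIV (*) \<epsilon>"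
    and coassoc: "x \<in> free_module B
      \<Longrightarrow> tensor_assoc (tensor_map \<Delta> id (\<Delta> x)) = tensor_map id \<Delta> (\<Delta> x)"
    and counit_left: "x \<in> free_module B \<Longrightarrow> contract_left \<epsilon> (\<Delta> x) = x"
    and counit_right: "x \<in> free_module B \<Longrightarrow> contract_right \<epsilon> (\<Delta> x) = x"

locale unital_bialgebra = unital_algebra B m u + counital_coalgebra B \<Delta> \<epsilon>
  for B :: "'b set"
    and m :: "('b \<Rightarrow>\<^sub>0 'k::{comm_ring,comm_monoid_mult}) \<Rightarrow> ('b \<Rightarrow>\<^sub>0 'k) \<Rightarrow> ('b \<Rightarrow>\<^sub>0 'k)"
    and u :: "'b \<Rightarrow>\<^sub>0 'k"
    and \<Delta> :: "('b \<Rightarrow>\<^sub>0 'k) \<Rightarrow> ('b \<times> 'b \<Rightarrow>\<^sub>0 'k)"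
    and \<epsilon> :: "('b \<Rightarrow>\<^sub>0 'k) \<Rightarrow> 'k" +
  assumes coproduct_mult: "\<lbrakk>x \<in> free_module B; y \<in> free_module B\<rbrakk>
      \<Longrightarrow> \<Delta> (m x y) = tensor_mult m (\<Delta> x) (\<Delta> y)"
    and coproduct_unit: "\<Delta> u = u \<otimes>\<^sub>k u"
    and counit_mult: "\<lbrakk>x \<in> free_module B; y \<in> free_module B\<rbrakk> \<Longrightarrow> \<epsilon> (m x y) = \<epsilon> x * \<epsilon> y"
    and counit_unit: "\<epsilon> u = 1"

section \<open>Decorated planar rooted forests\<close>

datatype 'a rtree = Node 'a "'a rtree list"

type_synonym 'a forest = "'a rtree list"

text \<open>
  A leaf is a vertex without children, so that the vertex of a one-vertex tree is a leaf.
\<close>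

fun decorated :: "'a set \<Rightarrow> 'a set \<Rightarrow> 'a rtree \<Rightarrow> bool"
  where "decorated X \<Omega> (Node a ts) \<longleftrightarrow>
    (if ts = [] then a \<in> X \<union> \<Omega> else a \<in> \<Omega>) \<and> (\<forall>t\<in>set ts. decorated X \<Omega> t)"

definition RT_trees :: "'a set \<Rightarrow> 'a set \<Rightarrow> 'a rtree set"
  where "RT_trees X \<Omega> = {t. decorated X \<Omega> t}"

definition RT_forests :: "'a set \<Rightarrow> 'a set \<Rightarrow> 'a forest set"
  where "RT_forests X \<Omega> = lists (RT_trees X \<Omega>)"

definition RT_mult ::
  "('a forest \<Rightarrow>\<^sub>0 'k::{comm_ring,comm_monoid_mult}) \<Rightarrow> ('a forest \<Rightarrow>\<^sub>0 'k) \<Rightarrow> ('a forest \<Rightarrow>\<^sub>0 'k)"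
  where "RT_mult = bilin_ext scale (\<lambda>F G. basis (F @ G))"

definition RT_unit :: "'a forest \<Rightarrow>\<^sub>0 'k::{comm_ring,comm_monoid_mult}"
  where "RT_unit = basis []"

definition RT_graft ::
  "'a \<Rightarrow> ('a forest \<Rightarrow>\<^sub>0 'k::{comm_ring,comm_monoid_mult}) \<Rightarrow> ('a forest \<Rightarrow>\<^sub>0 'k)"
  where "RT_graft \<omega> = lin_ext scale (\<lambda>F. basis [Node \<omega> F])"

text \<open>
  The following recursions are used on trees decorated by disjoint sets \<open>X\<close> and \<open>\<Omega>\<close>.
  If the root of such a tree has decoration in \<open>X\<close>, the tree has one vertex; otherwise the
  decoration is in \<open>\<Omega>\<close> and \<open>Node \<omega> F\<close> is the grafting of \<open>F\<close>.
\<close>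

fun RT_coproduct_tree ::
    "'a set \<Rightarrow> ('a \<Rightarrow> 'k::{comm_ring,comm_monoid_mult}) \<Rightarrow> ('a \<Rightarrow> 'k) \<Rightarrow> 'a rtree
      \<Rightarrow> ('a forest \<times> 'a forest \<Rightarrow>\<^sub>0 'k)"
  and RT_coproduct_forest ::
    "'a set \<Rightarrow> ('a \<Rightarrow> 'k) \<Rightarrow> ('a \<Rightarrow> 'k) \<Rightarrow> 'a forest \<Rightarrow> ('a forest \<times> 'a forest \<Rightarrow>\<^sub>0 'k)"
  where
    "RT_coproduct_tree X \<mu> lam (Node a F) =
      (if a \<in> X
       then basis [Node a F] \<otimes>\<^sub>k RT_unit + RT_unit \<otimes>\<^sub>k basis [Node a F]
            + scale (\<mu> a) (RT_unit \<otimes>\<^sub>k RT_unit)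
       else basis [Node a F] \<otimes>\<^sub>k RT_unit
            + tensor_map id (RT_graft a) (RT_coproduct_forest X \<mu> lam F)
            + scale (lam a) (basis F \<otimes>\<^sub>k RT_unit))"
  | "RT_coproduct_forest X \<mu> lam [] = RT_unit \<otimes>\<^sub>k RT_unit"
  | "RT_coproduct_forest X \<mu> lam [T] = RT_coproduct_tree X \<mu> lam T"
  | "RT_coproduct_forest X \<mu> lam (T # T' # F) =
      tensor_mult RT_mult (RT_coproduct_tree X \<mu> lam T) (RT_coproduct_forest X \<mu> lam (T' # F))"

fun RT_counit_tree ::
    "'a set \<Rightarrow> ('a \<Rightarrow> 'k::{comm_ring,comm_monoid_mult}) \<Rightarrow> ('a \<Rightarrow> 'k) \<Rightarrow> 'a rtree \<Rightarrow> 'k"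
  and RT_counit_forest ::
    "'a set \<Rightarrow> ('a \<Rightarrow> 'k) \<Rightarrow> ('a \<Rightarrow> 'k) \<Rightarrow> 'a forest \<Rightarrow> 'k"
  where
    "RT_counit_tree X \<mu> lam (Node a F) =
      (if a \<in> X then - \<mu> a else - (lam a * RT_counit_forest X \<mu> lam F))"
  | "RT_counit_forest X \<mu> lam [] = 1"
  | "RT_counit_forest X \<mu> lam (T # F) = RT_counit_tree X \<mu> lam T * RT_counit_forest X \<mu> lam F"

definition RT_coproduct ::
  "'a set \<Rightarrow> ('a \<Rightarrow> 'k::{comm_ring,comm_monoid_mult}) \<Rightarrow> ('a \<Rightarrow> 'k)
    \<Rightarrow> ('a forest \<Rightarrow>\<^sub>0 'k) \<Rightarrow> ('a forest \<times> 'a forest \<Rightarrow>\<^sub>0 'k)"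
  where "RT_coproduct X \<mu> lam = lin_ext scale (RT_coproduct_forest X \<mu> lam)"

definition RT_counit ::
  "'a set \<Rightarrow> ('a \<Rightarrow> 'k::{comm_ring,comm_monoid_mult}) \<Rightarrow> ('a \<Rightarrow> 'k) \<Rightarrow> ('a forest \<Rightarrow>\<^sub>0 'k) \<Rightarrow> 'k"
  where "RT_counit X \<mu> lam = lin_ext (*) (RT_counit_forest X \<mu> lam)"

section \<open>The universal property of the tensor product\<close>

context kmodule_on
begin

lemma scale_zero_left: "u \<in> M \<Longrightarrow> s 0 u = 0"
  using scale_add_left[of u 0 0] by simp

lemma scale_zero_right: "s c 0 = 0"
  using scale_add_right[of 0 0 c] zero_mem by simp

lemma sum_mem: "(\<And>i. i \<in> I \<Longrightarrow> f i \<in> M) \<Longrightarrow> sum f I \<in> M"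
  by (induction I rule: infinite_finite_induct) (auto intro: zero_mem add_mem)

lemma scale_sum: "(\<And>i. i \<in> I \<Longrightarrow> f i \<in> M) \<Longrightarrow> s c (sum f I) = (\<Sum>i\<in>I. s c (f i))"
  by (induction I rule: infinite_finite_induct)
    (auto simp: scale_zero_right scale_add_right sum_mem)

end

lemma lookup_scale [simp]: "Poly_Mapping.lookup (scale c f) b = c * Poly_Mapping.lookup f b"
  by (simp add: scale_def Poly_Mapping.map.rep_eq when_def)

lemma keys_scale: "Poly_Mapping.keys (scale c f) \<subseteq> Poly_Mapping.keys f"
  by (auto simp: in_keys_iff)

lemma kmodule_on_free_module: "kmodule_on (free_module B) scale"
proof
  show "u + v \<in> free_module B" if "u \<in> free_module B" "v \<in> free_module B"
    for u v :: "'a \<Rightarrow>\<^sub>0 'b"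
    using that Poly_Mapping.keys_add[of u v] by (auto simp: free_module_def)
  show "scale c u \<in> free_module B" if "u \<in> free_module B" for c and u :: "'a \<Rightarrow>\<^sub>0 'b"
    using that keys_scale[of c u] by (auto simp: free_module_def)
qed (auto simp: free_module_def poly_mapping_eq_iff fun_eq_iff lookup_add algebra_simps)

lemma kmodule_on_ring: "kmodule_on UNIV ((*) :: 'k::{comm_ring,comm_monoid_mult} \<Rightarrow> 'k \<Rightarrow> 'k)"
  by standard (simp_all add: algebra_simps)

lemma basis_mem: "b \<in> B \<Longrightarrow> basis b \<in> free_module B"
  by (auto simp: basis_def free_module_def)

lemma (in kmodule_on) lin_ext_eq:
  assumes "finite S" "Poly_Mapping.keys f \<subseteq> S" "\<And>b. b \<in> S \<Longrightarrow> g b \<in> M"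
  shows "lin_ext s g f = (\<Sum>b\<in>S. s (Poly_Mapping.lookup f b) (g b))"
  unfolding lin_ext_def using assms
  by (intro sum.mono_neutral_left) (auto simp: in_keys_iff scale_zero_left)

lemma (in kmodule_on) lin_ext_linear:
  fixes B :: "'b set"
  assumes g: "\<And>b. b \<in> B \<Longrightarrow> g b \<in> M"
  shows "linear_on (free_module B) scale M s (lin_ext s g)"
  unfolding linear_on_def
proof (intro conjI ballI allI)
  fix f :: "'b \<Rightarrow>\<^sub>0 'k" assume f: "f \<in> free_module B"
  show "lin_ext s g f \<in> M"
    unfolding lin_ext_def using f g by (intro sum_mem scale_mem) (auto simp: free_module_def)
  show "lin_ext s g (scale c f) = s c (lin_ext s g f)" for c
  proof -
    have *: "g b \<in> M" if "b \<in> Poly_Mapping.keys f" for b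
      using that f g by (auto simp: free_module_def)
    then show ?thesis
      by (simp add: lin_ext_eq[of "Poly_Mapping.keys f"] keys_scale scale_sum scale_mem scale_scale)
  qed
  fix h :: "'b \<Rightarrow>\<^sub>0 'k" assume h: "h \<in> free_module B"
  let ?S = "Poly_Mapping.keys f \<union> Poly_Mapping.keys h"
  have *: "g b \<in> M" if "b \<in> ?S" for b
    using that f h g by (auto simp: free_module_def)
  have "lin_ext s g (f + h) = (\<Sum>b\<in>?S. s (Poly_Mapping.lookup (f + h) b) (g b))"
    "lin_ext s g f = (\<Sum>b\<in>?S. s (Poly_Mapping.lookup f b) (g b))"
    "lin_ext s g h = (\<Sum>b\<in>?S. s (Poly_Mapping.lookup h b) (g b))"
    using * by (intro lin_ext_eq; simp add: Poly_Mapping.keys_add)+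
  then show "lin_ext s g (f + h) = lin_ext s g f + lin_ext s g h"
    using * by (simp add: lookup_add scale_add_left flip: sum.distrib)
qed

lemma (in kmodule_on) lin_ext_basis: "g b \<in> M \<Longrightarrow> lin_ext s g (basis b) = g b"
  using lin_ext_eq[of "{b}" "basis b" g] by (simp add: basis_def scale_one)

lemma linear_on_zero:
  assumes "linear_on (free_module B) scale M s h"
  shows "h 0 = 0"
proof -
  have "h (0 + 0) = h 0 + h 0"
    using assms unfolding linear_on_def free_module_def by (metis empty_subsetI keys_zero mem_Collect_eq)
  then show ?thesis by simp
qed

lemma linear_on_eq_lin_ext:
  assumes h: "linear_on (free_module B) scale M s h" and f: "f \<in> free_module B"
  shows "h f = lin_ext s (\<lambda>b. h (basis b)) f"
proof -
  interpret F: kmodule_on "free_module B" scale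
    by (rule kmodule_on_free_module)
  let ?K = "Poly_Mapping.keys f"
  have eq: "f = (\<Sum>b\<in>?K. scale (Poly_Mapping.lookup f b) (basis b))"
    by (auto simp: poly_mapping_eq_iff fun_eq_iff lookup_sum basis_def lookup_single when_def
        in_keys_iff if_distrib cong: if_cong)
  have "h (\<Sum>b\<in>S. scale (Poly_Mapping.lookup f b) (basis b))
      = (\<Sum>b\<in>S. s (Poly_Mapping.lookup f b) (h (basis b)))" if "finite S" "S \<subseteq> B" for S
    using that
  proof (induction S)
    case empty
    then show ?case by (simp add: linear_on_zero[OF h])
  next
    case (insert b S)
    have "(\<Sum>b\<in>S. scale (Poly_Mapping.lookup f b) (basis b)) \<in> free_module B"
      "(basis b :: _ \<Rightarrow>\<^sub>0 'b) \<in> free_module B"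
      using insert by (auto intro!: F.sum_mem F.scale_mem basis_mem)
    then show ?case
      using insert h by (simp add: linear_on_def F.scale_mem)
  qed
  from this[of ?K] show ?thesis
    using f by (simp add: lin_ext_def free_module_def flip: eq)
qed

lemma tensor_basis: "basis a \<otimes>\<^sub>k basis b = basis (a, b)"
proof -
  interpret F: kmodule_on "free_module UNIV" scale
    by (rule kmodule_on_free_module)
  show ?thesis
    by (simp add: tensor_def bilin_ext_def F.lin_ext_basis free_module_def)
qed

lemma tensor_bilinear:
  fixes A :: "'a set" and B :: "'b set"
  shows "bilinear_on (free_module A) scale (free_module B) scale (free_module (A \<times> B)) scale
    ((\<otimes>\<^sub>k) :: _ \<Rightarrow> _ \<Rightarrow> (_ \<Rightarrow>\<^sub>0 'k::{comm_ring,comm_monoid_mult}))"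
proof -
  interpret F: kmodule_on "free_module (A \<times> B)" scale
    by (rule kmodule_on_free_module)
  interpret U: kmodule_on "free_module UNIV" scale
    by (rule kmodule_on_free_module)
  have inner: "linear_on (free_module B) scale (free_module (A \<times> B)) scale
      (lin_ext scale (\<lambda>b. basis (a, b) :: _ \<Rightarrow>\<^sub>0 'k))" if "a \<in> A" for a
    using that by (intro F.lin_ext_linear basis_mem) auto
  have right: "linear_on (free_module A) scale (free_module (A \<times> B)) scale (\<lambda>f. f \<otimes>\<^sub>k h)"
    if "h \<in> free_module B" for h :: "'b \<Rightarrow>\<^sub>0 'k"
    unfolding tensor_def bilin_ext_def
    using that inner by (intro F.lin_ext_linear) (simp add: linear_on_def)
  have swap: "f \<otimes>\<^sub>k h = lin_ext scale (\<lambda>b. lin_ext scale (\<lambda>a. basis (a, b)) f) h"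
    for f :: "'a \<Rightarrow>\<^sub>0 'k" and h :: "'b \<Rightarrow>\<^sub>0 'k"
    unfolding tensor_def bilin_ext_def lin_ext_def
    by (simp add: U.scale_sum U.scale_scale free_module_def mult.commute)
      (rule sum.swap)
  have inner': "linear_on (free_module A) scale (free_module (A \<times> B)) scale
      (lin_ext scale (\<lambda>a. basis (a, b) :: _ \<Rightarrow>\<^sub>0 'k))" if "b \<in> B" for b
    using that by (intro F.lin_ext_linear basis_mem) auto
  have left: "linear_on (free_module B) scale (free_module (A \<times> B)) scale (\<lambda>h. f \<otimes>\<^sub>k h)"
    if "f \<in> free_module A" for f :: "'a \<Rightarrow>\<^sub>0 'k"
    unfolding swap using that inner' by (intro F.lin_ext_linear) (simp add: linear_on_def)
  show ?thesis
    using left right by (simp add: bilinear_on_def)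
qed

theorem tensor_universal:
  fixes A :: "'a set" and B :: "'b set"
    and s :: "'k::{comm_ring,comm_monoid_mult} \<Rightarrow> 'v::ab_group_add \<Rightarrow> 'v"
  assumes P: "kmodule_on P s"
    and \<phi>: "bilinear_on (free_module A) scale (free_module B) scale P s \<phi>"
  shows "\<exists>h. linear_on (free_module (A \<times> B)) scale P s h
      \<and> (\<forall>f\<in>free_module A. \<forall>g\<in>free_module B. h (f \<otimes>\<^sub>k g) = \<phi> f g)
      \<and> (\<forall>h'. linear_on (free_module (A \<times> B)) scale P s h'
            \<and> (\<forall>f\<in>free_module A. \<forall>g\<in>free_module B. h' (f \<otimes>\<^sub>k g) = \<phi> f g)
          \<longrightarrow> (\<forall>t\<in>free_module (A \<times> B). h' t = h t))"
proof -
  interpret P: kmodule_on P s by (rule P)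
  define h where "h = lin_ext s (\<lambda>(a, b). \<phi> (basis a) (basis b))"
  have mem: "\<phi> (basis a) (basis b) \<in> P" if "a \<in> A" "b \<in> B" for a b
    using \<phi> that by (simp add: bilinear_on_def linear_on_def basis_mem)
  have h: "linear_on (free_module (A \<times> B)) scale P s h"
    unfolding h_def using mem by (intro P.lin_ext_linear) auto
  have hb: "h (basis (a, b)) = \<phi> (basis a) (basis b)" if "a \<in> A" "b \<in> B" for a b
    using mem that by (simp add: h_def P.lin_ext_basis)
  have comp: "linear_on (free_module B) scale P s (\<lambda>g. h (f \<otimes>\<^sub>k g))"
    if "f \<in> free_module A" for f
    using h tensor_bilinear[of A B, where 'k = 'k] that by (simp add: bilinear_on_def linear_on_def)
  have comp': "linear_on (free_module A) scale P s (\<lambda>f. h (f \<otimes>\<^sub>k g))"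
    if "g \<in> free_module B" for g
    using h tensor_bilinear[of A B, where 'k = 'k] that by (simp add: bilinear_on_def linear_on_def)
  have cong: "lin_ext s p x = lin_ext s q x"
    if "\<And>b. b \<in> C \<Longrightarrow> p b = q b" "x \<in> free_module C" for p q C and x :: "'x \<Rightarrow>\<^sub>0 'k"
    using that unfolding lin_ext_def free_module_def by (intro sum.cong) auto
  have step: "h (basis a \<otimes>\<^sub>k g) = \<phi> (basis a) g" if "a \<in> A" "g \<in> free_module B" for a g
  proof -
    have "h (basis a \<otimes>\<^sub>k g) = lin_ext s (\<lambda>b. h (basis a \<otimes>\<^sub>k basis b)) g"
      by (rule linear_on_eq_lin_ext[OF comp]) (use that in \<open>auto intro: basis_mem\<close>)
    also have "\<dots> = lin_ext s (\<lambda>b. \<phi> (basis a) (basis b)) g"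
      by (rule cong[OF _ that(2)]) (simp add: tensor_basis hb that)
    also have "\<dots> = \<phi> (basis a) g"
      by (rule linear_on_eq_lin_ext[symmetric, of B P])
        (use that \<phi> in \<open>auto simp: bilinear_on_def basis_mem\<close>)
    finally show ?thesis .
  qed
  have eq: "h (f \<otimes>\<^sub>k g) = \<phi> f g" if "f \<in> free_module A" "g \<in> free_module B" for f g
  proof -
    have "h (f \<otimes>\<^sub>k g) = lin_ext s (\<lambda>a. h (basis a \<otimes>\<^sub>k g)) f"
      by (rule linear_on_eq_lin_ext[OF comp']) (use that in auto)
    also have "\<dots> = lin_ext s (\<lambda>a. \<phi> (basis a) g) f"
      by (rule cong[OF _ that(1)]) (simp add: step that)
    also have "\<dots> = \<phi> f g"
      by (rule linear_on_eq_lin_ext[symmetric, of A P "s" "\<lambda>f. \<phi> f g"])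
        (use that \<phi> in \<open>auto simp: bilinear_on_def\<close>)
    finally show ?thesis .
  qed
  have uniq: "h' t = h t"
    if h': "linear_on (free_module (A \<times> B)) scale P s h'"
      and e: "\<forall>f\<in>free_module A. \<forall>g\<in>free_module B. h' (f \<otimes>\<^sub>k g) = \<phi> f g"
      and t: "t \<in> free_module (A \<times> B)" for h' t
  proof -
    have "h' (basis p) = h (basis p)" if p: "p \<in> A \<times> B" for p
    proof -
      obtain a b where ab: "p = (a, b)" "a \<in> A" "b \<in> B" using p by auto
      have "h' (basis a \<otimes>\<^sub>k basis b) = \<phi> (basis a) (basis b)"
        using e ab by (simp add: basis_mem)
      then show ?thesis using ab by (simp add: tensor_basis hb)
    qed
    then show ?thesis
      unfolding linear_on_eq_lin_ext[OF h' t] linear_on_eq_lin_ext[OF h t]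
      by (rule cong[OF _ t])
  qed
  show ?thesis
    using h eq uniq by blast
qed

section \<open>The defining equations of the coproduct and the counit\<close>

context
  fixes X :: "'a set" and \<mu> lam :: "'a \<Rightarrow> 'k::{comm_ring,comm_monoid_mult}"
begin

lemma RT_coproduct_basis: "RT_coproduct X \<mu> lam (basis F) = RT_coproduct_forest X \<mu> lam F"
proof -
  interpret U: kmodule_on "free_module UNIV" scale
    by (rule kmodule_on_free_module)
  show ?thesis
    by (simp add: RT_coproduct_def U.lin_ext_basis free_module_def)
qed

lemma RT_counit_basis: "RT_counit X \<mu> lam (basis F) = RT_counit_forest X \<mu> lam F"
proof -
  interpret U: kmodule_on UNIV "(*) :: 'k \<Rightarrow> 'k \<Rightarrow> 'k"
    by (rule kmodule_on_ring)
  show ?thesis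
    by (simp add: RT_counit_def U.lin_ext_basis)
qed

lemma RT_graft_basis:
  "RT_graft \<omega> (basis F) = (basis [Node \<omega> F] :: 'a forest \<Rightarrow>\<^sub>0 'k)"
proof -
  interpret U: kmodule_on "free_module UNIV" scale
    by (rule kmodule_on_free_module)
  show ?thesis
    by (simp add: RT_graft_def U.lin_ext_basis free_module_def)
qed

lemma RT_coproduct_unit: "RT_coproduct X \<mu> lam RT_unit = RT_unit \<otimes>\<^sub>k RT_unit"
  unfolding RT_unit_def by (simp add: RT_coproduct_basis RT_unit_def)

lemma RT_coproduct_leaf:
  assumes "x \<in> X"
  shows "RT_coproduct X \<mu> lam (basis [Node x []]) =
    basis [Node x []] \<otimes>\<^sub>k RT_unit + RT_unit \<otimes>\<^sub>k basis [Node x []]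
    + scale (\<mu> x) (RT_unit \<otimes>\<^sub>k RT_unit)"
  using assms by (simp add: RT_coproduct_basis)

lemma RT_coproduct_graft:
  assumes "\<omega> \<notin> X"
  shows "RT_coproduct X \<mu> lam (RT_graft \<omega> (basis F)) =
    RT_graft \<omega> (basis F) \<otimes>\<^sub>k RT_unit
    + tensor_map id (RT_graft \<omega>) (RT_coproduct X \<mu> lam (basis F))
    + scale (lam \<omega>) (basis F \<otimes>\<^sub>k RT_unit)"
  using assms by (simp add: RT_coproduct_basis RT_graft_basis)

lemma RT_counit_unit: "RT_counit X \<mu> lam RT_unit = 1"
  by (simp add: RT_counit_basis RT_unit_def)

lemma RT_counit_leaf: "x \<in> X \<Longrightarrow> RT_counit X \<mu> lam (basis [Node x []]) = - \<mu> x"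
  by (simp add: RT_counit_basis)

lemma RT_counit_graft:
  "\<omega> \<notin> X \<Longrightarrow> RT_counit X \<mu> lam (RT_graft \<omega> (basis F)) = - lam \<omega> * RT_counit X \<mu> lam (basis F)"
  by (simp add: RT_counit_basis RT_graft_basis)

end

end

(*
  Linear maps on free modules are compared on basis elements. The two sides of the coassociativity
  and counit identities are multiplicative in the forest, so these identities reduce to trees, where
  they follow by structural induction from the recursion for grafted trees (a 1-cocycle condition
  deformed by lambda).
*)
theory Submission
  imports Defs
begin

section \<open>Linear maps on free modules\<close>

lemma free_module_UNIV [simp]: "free_module UNIV = UNIV"
  by (simp add: free_module_def)

lemma kmodule_on_poly_mapping: "kmodule_on UNIV scale"
  using kmodule_on_free_module[of UNIV] by simp

interpretation free: kmodule_on UNIV scale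
  by (rule kmodule_on_poly_mapping)

interpretation ring: kmodule_on UNIV "(*)"
  by (rule kmodule_on_ring)

text \<open>Taking whole types as carriers frees the identities below from membership premises;
  passing to decorated forests is left to separate closure lemmas.\<close>

abbreviation klinear where
  "klinear \<equiv> linear_on UNIV scale UNIV"

text \<open>Most rules collected here carry an inner linear map \<open>f\<close>, so that linearity
  of a nested composite decomposes from the outside in.\<close>

named_theorems klinear_intros

lemma klinear_ident [klinear_intros]: "klinear scale (\<lambda>x. x)"
  by (simp add: linear_on_def)

lemma klinear_id [klinear_intros]: "klinear scale id"
  by (simp add: linear_on_def)

lemma klinear_add [klinear_intros]:
  "klinear scale f \<Longrightarrow> klinear scale g \<Longrightarrow> klinear scale (\<lambda>x. f x + g x)"
  by (simp add: linear_on_def algebra_simps free.scale_add_right)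

lemma klinear_scale [klinear_intros]:
  "klinear scale f \<Longrightarrow> klinear scale (\<lambda>x. scale c (f x))"
  by (simp add: linear_on_def free.scale_add_right free.scale_scale mult.commute)

lemma klinear_mult_left [klinear_intros]:
  "klinear (*) f \<Longrightarrow> klinear (*) (\<lambda>x. f x * (c :: 'k :: {comm_ring,comm_monoid_mult}))"
  by (simp add: linear_on_def algebra_simps)

lemma klinear_mult_right [klinear_intros]:
  "klinear (*) f \<Longrightarrow> klinear (*) (\<lambda>x. (c :: 'k :: {comm_ring,comm_monoid_mult}) * f x)"
  by (simp add: linear_on_def algebra_simps)

lemma klinear_compose:
  "klinear s g \<Longrightarrow> klinear scale f \<Longrightarrow> klinear s (\<lambda>x. g (f x))"
  by (simp add: linear_on_def)

lemma klinear_lin_ext: "kmodule_on UNIV s \<Longrightarrow> klinear s (lin_ext s g)"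
  using kmodule_on.lin_ext_linear[of UNIV s UNIV g] by simp

lemma klinear_eqI:
  assumes "klinear s f" "klinear s g" "\<And>b. f (basis b) = g (basis b)"
  shows "f x = g x"
  using linear_on_eq_lin_ext[of UNIV UNIV s f x] linear_on_eq_lin_ext[of UNIV UNIV s g x] assms
  by simp

text \<open>The arguments are reduced one at a time: first \<open>x\<close> to a basis element with
  \<open>y\<close> arbitrary, then \<open>y\<close>. Hence linearity in the second argument is asked
  for only at a basis element in the first.\<close>

lemma klinear_eqI2:
  assumes "\<And>y. klinear s (\<lambda>x. f x y)" "\<And>y. klinear s (\<lambda>x. g x y)"
    and "\<And>b. klinear s (f (basis b))" "\<And>b. klinear s (g (basis b))"
    and "\<And>b c. f (basis b) (basis c) = g (basis b) (basis c)"
  shows "f x y = g x y"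
  by (rule klinear_eqI[of s "\<lambda>x. f x y" "\<lambda>x. g x y"])
    (auto intro: assms klinear_eqI[of s "f (basis _)" "g (basis _)"])

text \<open>\<open>bilin_ext\<close> is by construction a linear extension in its first argument
  only. Linearity in the second comes from the inner extensions: sums and scalars are pulled through
  the outer sum, using commutativity of the ring.\<close>

lemma klinear_bilin_ext_right:
  assumes "kmodule_on UNIV s"
  shows "klinear s (bilin_ext s g x)"
proof -
  interpret kmodule_on UNIV s by fact
  have "klinear s (lin_ext s (g a))" for a
    by (rule klinear_lin_ext[OF assms])
  then show ?thesis
    by (simp add: linear_on_def bilin_ext_def lin_ext_def[of s _ x] scale_add_right scale_sum
        scale_scale sum.distrib mult.commute)
qed

lemma bilin_ext_basis:
  assumes "kmodule_on UNIV s"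
  shows "bilin_ext s g (basis a) (basis b) = g a b"
  unfolding bilin_ext_def using assms by (simp add: kmodule_on.lin_ext_basis)

lemma lin_ext_mem:
  assumes "kmodule_on M s" "\<And>b. b \<in> B \<Longrightarrow> g b \<in> M" "f \<in> free_module B"
  shows "lin_ext s g f \<in> M"
proof -
  have "linear_on (free_module B) scale M s (lin_ext s g)"
    using assms(1,2) by (rule kmodule_on.lin_ext_linear)
  then show ?thesis
    using assms(3) by (simp add: linear_on_def)
qed

lemma bilin_ext_mem:
  assumes "kmodule_on M s" "\<And>a b. a \<in> A \<Longrightarrow> b \<in> B \<Longrightarrow> g a b \<in> M"
    and "f \<in> free_module A" "h \<in> free_module B"
  shows "bilin_ext s g f h \<in> M"
  unfolding bilin_ext_def using assms by (blast intro: lin_ext_mem)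

section \<open>Tensor products\<close>

lemma klinear_tensor_left [klinear_intros]:
  "klinear scale f \<Longrightarrow> klinear scale (\<lambda>x. f x \<otimes>\<^sub>k y)"
  unfolding tensor_def bilin_ext_def
  by (rule klinear_compose[OF klinear_lin_ext[OF kmodule_on_poly_mapping]])

lemma klinear_tensor_right [klinear_intros]:
  "klinear scale f \<Longrightarrow> klinear scale (\<lambda>x. y \<otimes>\<^sub>k f x)"
  unfolding tensor_def
  by (rule klinear_compose[OF klinear_bilin_ext_right[OF kmodule_on_poly_mapping]])

lemma klinear_simps:
  assumes "klinear s f"
  shows "f (x + y) = f x + f y" "f (scale c x) = s c (f x)"
  using assms by (simp_all add: linear_on_def)

lemmas tensor_linear =
  klinear_simps[OF klinear_tensor_left[OF klinear_ident]]
  klinear_simps[OF klinear_tensor_right[OF klinear_ident]]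

lemma tensor_mem:
  "f \<in> free_module A \<Longrightarrow> h \<in> free_module B \<Longrightarrow> f \<otimes>\<^sub>k h \<in> free_module (A \<times> B)"
  unfolding tensor_def
  by (intro bilin_ext_mem[OF kmodule_on_free_module, of A B]) (auto intro: basis_mem)

lemma klinear_tensor_map [klinear_intros]:
  "klinear scale f \<Longrightarrow> klinear scale (\<lambda>x. tensor_map \<phi> \<psi> (f x))"
  unfolding tensor_map_def by (rule klinear_compose[OF klinear_lin_ext[OF kmodule_on_poly_mapping]])

lemma klinear_tensor_assoc [klinear_intros]:
  "klinear scale f \<Longrightarrow> klinear scale (\<lambda>x. tensor_assoc (f x))"
  unfolding tensor_assoc_def by (rule klinear_compose[OF klinear_lin_ext[OF kmodule_on_poly_mapping]])

lemma klinear_contract_left [klinear_intros]: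
  "klinear scale f \<Longrightarrow> klinear scale (\<lambda>x. contract_left \<epsilon> (f x))"
  unfolding contract_left_def by (rule klinear_compose[OF klinear_lin_ext[OF kmodule_on_poly_mapping]])

lemma klinear_contract_right [klinear_intros]:
  "klinear scale f \<Longrightarrow> klinear scale (\<lambda>x. contract_right \<epsilon> (f x))"
  unfolding contract_right_def by (rule klinear_compose[OF klinear_lin_ext[OF kmodule_on_poly_mapping]])

lemma klinear_tensor_mult_left [klinear_intros]:
  "klinear scale f \<Longrightarrow> klinear scale (\<lambda>x. tensor_mult m (f x) y)"
  unfolding tensor_mult_def bilin_ext_def
  by (rule klinear_compose[OF klinear_lin_ext[OF kmodule_on_poly_mapping]])

lemma klinear_tensor_mult_right [klinear_intros]:
  "klinear scale f \<Longrightarrow> klinear scale (\<lambda>x. tensor_mult m y (f x))"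
  unfolding tensor_mult_def
  by (rule klinear_compose[OF klinear_bilin_ext_right[OF kmodule_on_poly_mapping]])

lemma tensor_map_basis [simp]:
  "tensor_map \<phi> \<psi> (basis (a, b)) = \<phi> (basis a) \<otimes>\<^sub>k \<psi> (basis b)"
  by (simp add: tensor_map_def free.lin_ext_basis)

lemma tensor_assoc_basis [simp]: "tensor_assoc (basis ((a, b), c)) = basis (a, b, c)"
  by (simp add: tensor_assoc_def free.lin_ext_basis)

lemma contract_left_basis [simp]:
  "contract_left \<epsilon> (basis (a, b)) = scale (\<epsilon> (basis a)) (basis b)"
  by (simp add: contract_left_def free.lin_ext_basis)

lemma contract_right_basis [simp]:
  "contract_right \<epsilon> (basis (a, b)) = scale (\<epsilon> (basis b)) (basis a)"
  by (simp add: contract_right_def free.lin_ext_basis)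

lemma tensor_mult_basis [simp]:
  "tensor_mult m (basis (a, b)) (basis (c, d)) = m (basis a) (basis c) \<otimes>\<^sub>k m (basis b) (basis d)"
  by (simp add: tensor_mult_def bilin_ext_basis kmodule_on_poly_mapping)

lemmas tensor_map_linear = klinear_simps[OF klinear_tensor_map[OF klinear_ident]]
lemmas tensor_assoc_linear = klinear_simps[OF klinear_tensor_assoc[OF klinear_ident]]
lemmas contract_left_linear = klinear_simps[OF klinear_contract_left[OF klinear_ident]]
lemmas contract_right_linear = klinear_simps[OF klinear_contract_right[OF klinear_ident]]

text \<open>Linearity of \<phi> and \<psi> makes both sides bilinear, so agreement on tensors of
  basis elements suffices.\<close>

lemma tensor_map_tensor:
  assumes "klinear scale \<phi>" "klinear scale \<psi>"
  shows "tensor_map \<phi> \<psi> (x \<otimes>\<^sub>k y) = \<phi> x \<otimes>\<^sub>k \<psi> y"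
proof (rule klinear_eqI2[where s = scale and x = x and y = y])
qed (use assms in \<open>auto intro!: klinear_intros simp: tensor_basis\<close>)

lemma contract_left_tensor:
  assumes "klinear (*) \<epsilon>"
  shows "contract_left \<epsilon> (x \<otimes>\<^sub>k y) = scale (\<epsilon> x) y"
proof (rule klinear_eqI2[where s = scale and x = x and y = y])
  \<comment> \<open>The variable sits in the scalar, so this rests on linearity of \<epsilon> and on
    additivity of \<open>scale\<close> in its scalar.\<close>
  show "klinear scale (\<lambda>x. scale (\<epsilon> x) y)" for y
    using assms by (simp add: linear_on_def free.scale_add_left free.scale_scale)
qed (auto intro!: klinear_intros simp: tensor_basis)

lemma contract_right_tensor:
  fixes x :: "'a \<Rightarrow>\<^sub>0 'k::{comm_ring,comm_monoid_mult}"
  assumes "klinear (*) \<epsilon>"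
  shows "contract_right \<epsilon> (x \<otimes>\<^sub>k y) = scale (\<epsilon> y) x"
proof (rule klinear_eqI2[where s = scale and x = x and y = y])
  show "klinear scale (\<lambda>y. scale (\<epsilon> y) (basis b))" for b :: 'a
    using assms by (simp add: linear_on_def free.scale_add_left free.scale_scale)
qed (auto intro!: klinear_intros simp: tensor_basis)

lemma tensor_map_mem:
  assumes "\<And>a. a \<in> A \<Longrightarrow> \<phi> (basis a) \<in> free_module C"
    and "\<And>b. b \<in> B \<Longrightarrow> \<psi> (basis b) \<in> free_module D"
    and "f \<in> free_module (A \<times> B)"
  shows "tensor_map \<phi> \<psi> f \<in> free_module (C \<times> D)"
  unfolding tensor_map_def using assms
  by (intro lin_ext_mem[OF kmodule_on_free_module, of "A \<times> B"]) (auto intro: tensor_mem)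

lemma tensor_mult_mem:
  assumes "\<And>a b. a \<in> B \<Longrightarrow> b \<in> B \<Longrightarrow> m (basis a) (basis b) \<in> free_module B"
    and "f \<in> free_module (B \<times> B)" "h \<in> free_module (B \<times> B)"
  shows "tensor_mult m f h \<in> free_module (B \<times> B)"
  unfolding tensor_mult_def using assms
  by (intro bilin_ext_mem[OF kmodule_on_free_module, of "B \<times> B" "B \<times> B"]) (auto intro: tensor_mem)

section \<open>The algebra of forests\<close>

lemma klinear_RT_mult_left [klinear_intros]:
  "klinear scale f \<Longrightarrow> klinear scale (\<lambda>x. RT_mult (f x) y)"
  unfolding RT_mult_def bilin_ext_def
  by (rule klinear_compose[OF klinear_lin_ext[OF kmodule_on_poly_mapping]])

lemma klinear_RT_mult_right [klinear_intros]:
  "klinear scale f \<Longrightarrow> klinear scale (\<lambda>x. RT_mult y (f x))"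
  unfolding RT_mult_def
  by (rule klinear_compose[OF klinear_bilin_ext_right[OF kmodule_on_poly_mapping]])

lemma RT_mult_basis [simp]: "RT_mult (basis F) (basis G) = basis (F @ G)"
  by (simp add: RT_mult_def bilin_ext_basis kmodule_on_poly_mapping)

lemma RT_mult_unit [simp]: "RT_mult RT_unit x = x" "RT_mult x RT_unit = x"
  unfolding RT_unit_def
  by (rule klinear_eqI[where s = scale and x = x]; auto intro!: klinear_intros)+

lemmas RT_mult_linear =
  klinear_simps[OF klinear_RT_mult_left[OF klinear_ident]]
  klinear_simps[OF klinear_RT_mult_right[OF klinear_ident]]

lemma RT_mult_assoc: "RT_mult (RT_mult x y) z = RT_mult x (RT_mult y z)"
proof (rule klinear_eqI2[where s = scale and x = x and y = y])
  show "RT_mult (RT_mult (basis F) (basis G)) z = RT_mult (basis F) (RT_mult (basis G) z)" for F G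
    by (rule klinear_eqI[where s = scale and x = z]) (auto intro!: klinear_intros)
qed (auto intro!: klinear_intros)

lemma RT_mult_mem:
  assumes "x \<in> free_module (RT_forests X \<Omega>)" "y \<in> free_module (RT_forests X \<Omega>)"
  shows "RT_mult x y \<in> free_module (RT_forests X \<Omega>)"
  unfolding RT_mult_def using assms
  by (intro bilin_ext_mem[OF kmodule_on_free_module, of "RT_forests X \<Omega>" "RT_forests X \<Omega>"])
    (auto simp: RT_forests_def intro!: basis_mem)

section \<open>Products on the tensor square and the tensor cube\<close>

abbreviation tm where "tm \<equiv> tensor_mult RT_mult"

lemma tensor_mult_unit [simp]:
  "tm (RT_unit \<otimes>\<^sub>k RT_unit) u = u" "tm u (RT_unit \<otimes>\<^sub>k RT_unit) = u"
  unfolding RT_unit_def tensor_basis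
  by (rule klinear_eqI[where s = scale and x = u]; auto intro!: klinear_intros simp: tensor_basis)+

lemma tensor_mult_assoc: "tm (tm u v) w = tm u (tm v w)"
proof (rule klinear_eqI2[where s = scale and x = u and y = v])
  show "tm (tm (basis p) (basis q)) w = tm (basis p) (tm (basis q) w)" for p q
    by (rule klinear_eqI[where s = scale and x = w]; cases p; cases q)
      (auto intro!: klinear_intros simp: tensor_basis)
qed (auto intro!: klinear_intros)

text \<open>The product of the tensor cube, with respect to which both composites in the
  coassociativity law are multiplicative. Triples are nested to the right to match the target of
  \<open>tensor_assoc\<close>.\<close>

definition triple_mult ::
  "('a forest \<times> 'a forest \<times> 'a forest \<Rightarrow>\<^sub>0 'k::{comm_ring,comm_monoid_mult}) \<Rightarrow> _ \<Rightarrow> _"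
  where "triple_mult = bilin_ext scale (\<lambda>(a, b, c) (a', b', c'). basis (a @ a', b @ b', c @ c'))"

lemma klinear_triple_mult_left [klinear_intros]:
  "klinear scale f \<Longrightarrow> klinear scale (\<lambda>x. triple_mult (f x) y)"
  unfolding triple_mult_def bilin_ext_def
  by (rule klinear_compose[OF klinear_lin_ext[OF kmodule_on_poly_mapping]])

lemma klinear_triple_mult_right [klinear_intros]:
  "klinear scale f \<Longrightarrow> klinear scale (\<lambda>x. triple_mult y (f x))"
  unfolding triple_mult_def
  by (rule klinear_compose[OF klinear_bilin_ext_right[OF kmodule_on_poly_mapping]])

lemma triple_mult_basis [simp]:
  "triple_mult (basis (a, b, c)) (basis (a', b', c')) = basis (a @ a', b @ b', c @ c')"
  by (simp add: triple_mult_def bilin_ext_basis kmodule_on_poly_mapping)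

text \<open>The shape produced by id \<otimes> \<Delta>: a coproduct, hence an arbitrary element of
  the tensor square, fills the last two factors.\<close>

lemma triple_mult_tensor:
  "triple_mult (basis a \<otimes>\<^sub>k u) (basis c \<otimes>\<^sub>k v) = basis (a @ c) \<otimes>\<^sub>k tm u v"
proof (rule klinear_eqI2[where s = scale and x = u and y = v])
  show "triple_mult (basis a \<otimes>\<^sub>k basis p) (basis c \<otimes>\<^sub>k basis q)
      = basis (a @ c) \<otimes>\<^sub>k tm (basis p) (basis q)" for p q
    by (cases p; cases q) (simp add: tensor_basis)
qed (auto intro!: klinear_intros)

text \<open>The counterpart for \<Delta> \<otimes> id, where a coproduct fills the first two factors
  before reassociation.\<close>

lemma triple_mult_tensor_assoc:
  "triple_mult (tensor_assoc (u \<otimes>\<^sub>k basis b)) (tensor_assoc (v \<otimes>\<^sub>k basis d))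
    = tensor_assoc (tm u v \<otimes>\<^sub>k basis (b @ d))"
proof (rule klinear_eqI2[where s = scale and x = u and y = v])
  show "triple_mult (tensor_assoc (basis p \<otimes>\<^sub>k basis b)) (tensor_assoc (basis q \<otimes>\<^sub>k basis d))
      = tensor_assoc (tm (basis p) (basis q) \<otimes>\<^sub>k basis (b @ d))" for p q
    by (cases p; cases q) (simp add: tensor_basis)
qed (auto intro!: klinear_intros)

lemma klinear_RT_graft [klinear_intros]:
  "klinear scale f \<Longrightarrow> klinear scale (\<lambda>x. RT_graft \<omega> (f x))"
  unfolding RT_graft_def by (rule klinear_compose[OF klinear_lin_ext[OF kmodule_on_poly_mapping]])

text \<open>A grafted tree calls for the hypothesis on its forest of children as a whole. All
  nonempty forests share one case, whereas the recursion of the coproduct sets singletons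
  apart.\<close>

lemma rtree_forest_induct [case_names Node Nil Cons]:
  assumes Node: "\<And>a F. Q F \<Longrightarrow> P (Node a F)"
    and Nil: "Q []"
    and Cons: "\<And>T F. P T \<Longrightarrow> Q F \<Longrightarrow> Q (T # F)"
  shows "P T" "Q F"
proof -
  \<comment> \<open>List induction turns the hypothesis on each child, as supplied by induction on
    trees, into \<open>Q\<close> for the forest of children.\<close>
  have forest: "Q F" if "\<And>T. T \<in> set F \<Longrightarrow> P T" for F
    using that by (induction F) (auto intro: Nil Cons)
  show tree: "P T" for T
    by (induction T) (auto intro: Node forest)
  show "Q F"
    by (rule forest) (rule tree)
qed

section \<open>Coproduct and counit\<close>

context
  fixes X :: "'a set" and \<mu> lam :: "'a \<Rightarrow> 'k::{comm_ring,comm_monoid_mult}"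
begin

abbreviation "\<Delta>T \<equiv> RT_coproduct_tree X \<mu> lam"
abbreviation "\<Delta>F \<equiv> RT_coproduct_forest X \<mu> lam"
abbreviation "\<Delta> \<equiv> RT_coproduct X \<mu> lam"
abbreviation "\<epsilon> \<equiv> RT_counit X \<mu> lam"

lemma klinear_RT_coproduct [klinear_intros]:
  "klinear scale f \<Longrightarrow> klinear scale (\<lambda>x. \<Delta> (f x))"
  unfolding RT_coproduct_def by (rule klinear_compose[OF klinear_lin_ext[OF kmodule_on_poly_mapping]])

lemma klinear_RT_counit [klinear_intros]:
  "klinear scale f \<Longrightarrow> klinear (*) (\<lambda>x. \<epsilon> (f x))"
  unfolding RT_counit_def by (rule klinear_compose[OF klinear_lin_ext[OF kmodule_on_ring]])

lemmas klinear_RT_coproduct' [klinear_intros] = klinear_RT_coproduct[OF klinear_ident]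
lemmas klinear_RT_counit' [klinear_intros] = klinear_RT_counit[OF klinear_ident]

text \<open>For a singleton the second factor is the coproduct of the empty forest, which is neutral
  for \<open>tm\<close>; so one recursion covers both nonempty clauses.\<close>

lemma RT_coproduct_forest_Cons: "\<Delta>F (T # F) = tm (\<Delta>T T) (\<Delta>F F)"
  by (cases F) simp_all

lemma RT_coproduct_forest_append: "\<Delta>F (F @ G) = tm (\<Delta>F F) (\<Delta>F G)"
  by (induction F)
    (simp_all add: RT_coproduct_forest_Cons tensor_mult_assoc del: RT_coproduct_forest.simps(3))

lemma RT_counit_forest_append:
  "RT_counit_forest X \<mu> lam (F @ G) = RT_counit_forest X \<mu> lam F * RT_counit_forest X \<mu> lam G"
  by (induction F) (simp_all add: mult.assoc)

lemma RT_coproduct_mult: "\<Delta> (RT_mult x y) = tm (\<Delta> x) (\<Delta> y)"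
  by (rule klinear_eqI2[where s = scale and x = x and y = y])
    (auto intro!: klinear_intros simp: RT_coproduct_basis RT_coproduct_forest_append)

lemma RT_counit_mult: "\<epsilon> (RT_mult x y) = \<epsilon> x * \<epsilon> y"
  by (rule klinear_eqI2[where s = "(*)" and x = x and y = y])
    (auto intro!: klinear_intros simp: RT_counit_basis RT_counit_forest_append)

section \<open>The counit axioms\<close>

text \<open>\<epsilon> is multiplicative and scalars move freely through the product. This reduces
  the left counit law from forests to trees.\<close>

lemma contract_left_mult:
  "contract_left \<epsilon> (tm u v) = RT_mult (contract_left \<epsilon> u) (contract_left \<epsilon> v)"
proof (rule klinear_eqI2[where s = scale and x = u and y = v])
  fix p q :: "'a forest \<times> 'a forest"
  show "contract_left \<epsilon> (tm (basis p) (basis q))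
      = RT_mult (contract_left \<epsilon> (basis p)) (contract_left \<epsilon> (basis q))"
    by (cases p; cases q) (simp add: tensor_basis RT_counit_basis RT_counit_forest_append
        RT_mult_linear free.scale_scale mult.commute)
qed (auto intro!: klinear_intros)

lemma contract_right_mult:
  "contract_right \<epsilon> (tm u v) = RT_mult (contract_right \<epsilon> u) (contract_right \<epsilon> v)"
proof (rule klinear_eqI2[where s = scale and x = u and y = v])
  fix p q :: "'a forest \<times> 'a forest"
  show "contract_right \<epsilon> (tm (basis p) (basis q))
      = RT_mult (contract_right \<epsilon> (basis p)) (contract_right \<epsilon> (basis q))"
    by (cases p; cases q) (simp add: tensor_basis RT_counit_basis RT_counit_forest_append
        RT_mult_linear free.scale_scale mult.commute)
qed (auto intro!: klinear_intros)

text \<open>Grafting acts on the right factor and the contraction evaluates the left one, so they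
  commute.\<close>

lemma contract_left_graft:
  fixes u :: "'a forest \<times> 'a forest \<Rightarrow>\<^sub>0 'k"
  shows "contract_left \<epsilon> (tensor_map id (RT_graft \<omega>) u) = RT_graft \<omega> (contract_left \<epsilon> u)"
proof (rule klinear_eqI[where s = scale and x = u])
  fix p :: "'a forest \<times> 'a forest"
  show "contract_left \<epsilon> (tensor_map id (RT_graft \<omega>) (basis p)) = RT_graft \<omega> (contract_left \<epsilon> (basis p))"
    by (cases p) (simp add: tensor_basis RT_graft_basis
        klinear_simps[OF klinear_RT_graft[OF klinear_ident]])
qed (auto intro!: klinear_intros)

text \<open>Here the grafted factor is the one evaluated, so grafting becomes a scalar;
  \<open>\<omega> \<notin> X\<close> selects the grafting clause of the counit.\<close>

lemma contract_right_graft: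
  fixes u :: "'a forest \<times> 'a forest \<Rightarrow>\<^sub>0 'k"
  assumes "\<omega> \<notin> X"
  shows "contract_right \<epsilon> (tensor_map id (RT_graft \<omega>) u) = scale (- lam \<omega>) (contract_right \<epsilon> u)"
proof (rule klinear_eqI[where s = scale and x = u])
  fix p :: "'a forest \<times> 'a forest"
  show "contract_right \<epsilon> (tensor_map id (RT_graft \<omega>) (basis p))
      = scale (- lam \<omega>) (contract_right \<epsilon> (basis p))"
    using assms by (cases p) (simp add: tensor_basis RT_graft_basis RT_counit_basis free.scale_scale)
qed (auto intro!: klinear_intros)

lemma scale_neg_add: "scale (- c) x + scale c x = 0"
  by (simp flip: free.scale_add_left add: free.scale_zero_left)

text \<open>At a root in \<open>X\<close>, the counit \<open>- \<mu> a\<close> of the tree cancels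
  the constant term of its coproduct.\<close>

lemma contract_left_forest:
  "contract_left \<epsilon> (\<Delta>T T) = basis [T]" "contract_left \<epsilon> (\<Delta>F F) = basis F"
proof (induction T and F rule: rtree_forest_induct)
  case (Node a F)
  show ?case
  proof (cases "a \<in> X")
    case True
    then show ?thesis
      by (simp add: contract_left_linear contract_left_tensor[OF klinear_RT_counit']
          RT_counit_basis RT_counit_unit free.scale_one scale_neg_add)
  next
    case False
    \<comment> \<open>The counit of the tree, in the first term, cancels the \<lambda>-term; the
      grafted middle term gives the tree itself by the induction hypothesis.\<close>
    then show ?thesis
      using Node scale_neg_add[of "lam a * RT_counit_forest X \<mu> lam F" RT_unit]
      by (simp add: contract_left_linear contract_left_tensor[OF klinear_RT_counit'] RT_counit_basis
          contract_left_graft RT_graft_basis free.scale_scale algebra_simps)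
  qed
next
  case Nil
  show ?case
    by (simp add: contract_left_tensor[OF klinear_RT_counit'] RT_counit_unit free.scale_one)
      (simp add: RT_unit_def)
next
  case (Cons T F)
  then show ?case
    by (simp add: RT_coproduct_forest_Cons contract_left_mult del: RT_coproduct_forest.simps(3))
qed

lemma contract_right_forest:
  "contract_right \<epsilon> (\<Delta>T T) = basis [T]" "contract_right \<epsilon> (\<Delta>F F) = basis F"
proof (induction T and F rule: rtree_forest_induct)
  case (Node a F)
  show ?case
  proof (cases "a \<in> X")
    case True
    then show ?thesis
      by (simp add: contract_right_linear contract_right_tensor[OF klinear_RT_counit']
          RT_counit_basis RT_counit_unit free.scale_one add.assoc scale_neg_add)
  next
    case False
    \<comment> \<open>Now the first term gives the tree itself, while the middle term yields
      \<open>- lam a\<close> times \<open>basis F\<close> and cancels the \<lambda>-term.\<close>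
    then show ?thesis
      using Node
      by (simp add: contract_right_linear contract_right_tensor[OF klinear_RT_counit']
          RT_counit_unit contract_right_graft free.scale_one add.assoc scale_neg_add)
  qed
next
  case Nil
  show ?case
    by (simp add: contract_right_tensor[OF klinear_RT_counit'] RT_counit_unit free.scale_one)
      (simp add: RT_unit_def)
next
  case (Cons T F)
  then show ?case
    by (simp add: RT_coproduct_forest_Cons contract_right_mult del: RT_coproduct_forest.simps(3))
qed

section \<open>Coassociativity\<close>

text \<open>Multiplicativity of \<Delta> in the left factor, carried through the associator; with
  \<open>coassoc_right_mult\<close> it reduces coassociativity to trees.\<close>

lemma coassoc_left_mult:
  "tensor_assoc (tensor_map \<Delta> id (tm u v))
    = triple_mult (tensor_assoc (tensor_map \<Delta> id u)) (tensor_assoc (tensor_map \<Delta> id v))"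
proof (rule klinear_eqI2[where s = scale and x = u and y = v])
  fix p q :: "'a forest \<times> 'a forest"
  show "tensor_assoc (tensor_map \<Delta> id (tm (basis p) (basis q)))
    = triple_mult (tensor_assoc (tensor_map \<Delta> id (basis p)))
        (tensor_assoc (tensor_map \<Delta> id (basis q)))"
    by (cases p; cases q)
      (simp add: tensor_basis triple_mult_tensor_assoc RT_coproduct_basis RT_coproduct_forest_append)
qed (auto intro!: klinear_intros)

lemma coassoc_right_mult:
  "tensor_map id \<Delta> (tm u v) = triple_mult (tensor_map id \<Delta> u) (tensor_map id \<Delta> v)"
proof (rule klinear_eqI2[where s = scale and x = u and y = v])
  fix p q :: "'a forest \<times> 'a forest"
  show "tensor_map id \<Delta> (tm (basis p) (basis q))
    = triple_mult (tensor_map id \<Delta> (basis p)) (tensor_map id \<Delta> (basis q))"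
    by (cases p; cases q)
      (simp add: tensor_basis triple_mult_tensor RT_coproduct_basis RT_coproduct_forest_append)
qed (auto intro!: klinear_intros)

text \<open>\<Delta> acts on the first factor and grafting on the last, so they commute; after
  reassociation the last factor is reached through two nested \<open>tensor_map\<close>s.\<close>

lemma coassoc_left_graft:
  fixes u :: "'a forest \<times> 'a forest \<Rightarrow>\<^sub>0 'k"
  shows "tensor_assoc (tensor_map \<Delta> id (tensor_map id (RT_graft \<omega>) u))
    = tensor_map id (tensor_map id (RT_graft \<omega>)) (tensor_assoc (tensor_map \<Delta> id u))"
proof (rule klinear_eqI[where s = scale and x = u])
  fix p :: "'a forest \<times> 'a forest"
  obtain a b where p: "p = (a, b)" by fastforce
  \<comment> \<open>To be applied to \<open>\<Delta> (basis a)\<close>, which need not be a basis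
    element; hence the claim for arbitrary \<open>v\<close>.\<close>
  have "tensor_assoc (v \<otimes>\<^sub>k basis [Node \<omega> b])
      = tensor_map id (tensor_map id (RT_graft \<omega>)) (tensor_assoc (v \<otimes>\<^sub>k basis b))"
    for v :: "'a forest \<times> 'a forest \<Rightarrow>\<^sub>0 'k"
  proof (rule klinear_eqI[where s = scale and x = v])
    fix q :: "'a forest \<times> 'a forest"
    show "tensor_assoc (basis q \<otimes>\<^sub>k basis [Node \<omega> b])
        = tensor_map id (tensor_map id (RT_graft \<omega>)) (tensor_assoc (basis q \<otimes>\<^sub>k basis b))"
      by (cases q) (simp add: tensor_basis RT_graft_basis)
  qed (auto intro!: klinear_intros)
  then show "tensor_assoc (tensor_map \<Delta> id (tensor_map id (RT_graft \<omega>) (basis p)))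
      = tensor_map id (tensor_map id (RT_graft \<omega>)) (tensor_assoc (tensor_map \<Delta> id (basis p)))"
    by (simp add: p tensor_map_tensor klinear_intros RT_graft_basis)
qed (auto intro!: klinear_intros)

text \<open>The recursion for a grafted tree, applied in the second factor. The outer two of its
  three terms end in 1, and a \<otimes> (y \<otimes> 1) is the reassociation of (a \<otimes> y)
  \<otimes> 1.\<close>

lemma coassoc_right_graft:
  fixes u :: "'a forest \<times> 'a forest \<Rightarrow>\<^sub>0 'k"
  assumes "\<omega> \<notin> X"
  shows "tensor_map id \<Delta> (tensor_map id (RT_graft \<omega>) u)
    = tensor_assoc (tensor_map id (RT_graft \<omega>) u \<otimes>\<^sub>k RT_unit)
      + tensor_map id (tensor_map id (RT_graft \<omega>)) (tensor_map id \<Delta> u)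
      + scale (lam \<omega>) (tensor_assoc (u \<otimes>\<^sub>k RT_unit))"
proof (rule klinear_eqI[where s = scale and x = u])
  fix p :: "'a forest \<times> 'a forest"
  show "tensor_map id \<Delta> (tensor_map id (RT_graft \<omega>) (basis p))
    = tensor_assoc (tensor_map id (RT_graft \<omega>) (basis p) \<otimes>\<^sub>k RT_unit)
      + tensor_map id (tensor_map id (RT_graft \<omega>)) (tensor_map id \<Delta> (basis p))
      + scale (lam \<omega>) (tensor_assoc (basis p \<otimes>\<^sub>k RT_unit))"
    using assms
    by (cases p) (simp add: tensor_map_tensor klinear_intros RT_coproduct_graft tensor_linear
        tensor_basis RT_unit_def RT_graft_basis RT_coproduct_basis)
qed (auto intro!: klinear_intros)

text \<open>For a grafted tree T with children F, re-expanding the coproduct of T inside T \<otimes>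
  1 on the left produces exactly the terms ending in 1 that \<open>coassoc_right_graft\<close> and
  the first and last summands give on the right. What remains is coassociativity for F with the last
  factor grafted.\<close>

lemma coassoc_forest:
  "tensor_assoc (tensor_map \<Delta> id (\<Delta>T T)) = tensor_map id \<Delta> (\<Delta>T T)"
  "tensor_assoc (tensor_map \<Delta> id (\<Delta>F F)) = tensor_map id \<Delta> (\<Delta>F F)"
proof (induction T and F rule: rtree_forest_induct)
  case (Node a F)
  \<comment> \<open>The coproduct of the tree contains the tree itself as a factor, which is
    expanded once more.\<close>
  have \<Delta>: "\<Delta> (basis [Node a F]) = \<Delta>T (Node a F)"
    by (simp add: RT_coproduct_basis)
  show ?case
  proof (cases "a \<in> X")
    case True
    then show ?thesis
      using RT_coproduct_unit[of X \<mu> lam]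
      by (simp add: tensor_map_linear tensor_assoc_linear tensor_map_tensor klinear_intros \<Delta>
          tensor_linear tensor_basis RT_unit_def algebra_simps)
  next
    case False
    have unit: "\<Delta> RT_unit = RT_unit \<otimes>\<^sub>k RT_unit"
      by (rule RT_coproduct_unit)
    \<comment> \<open>Needed with \<open>G\<close> the whole tree and with \<open>G = F\<close>, for
      the terms whose last two factors are 1.\<close>
    have assoc: "tensor_assoc (basis G \<otimes>\<^sub>k RT_unit \<otimes>\<^sub>k RT_unit)
        = basis G \<otimes>\<^sub>k ((RT_unit \<otimes>\<^sub>k RT_unit) :: 'a forest \<times> 'a forest \<Rightarrow>\<^sub>0 'k)"
      for G :: "'a forest"
      by (simp add: RT_unit_def tensor_basis)
    show ?thesis
      using False Node
      by (simp add: tensor_map_linear tensor_assoc_linear tensor_map_tensor klinear_intros \<Delta> unit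
          tensor_linear assoc coassoc_left_graft coassoc_right_graft RT_coproduct_basis algebra_simps
          del: id_apply)
        (simp add: assoc)
  qed
next
  case Nil
  show ?case
    by (simp add: tensor_map_tensor klinear_intros RT_coproduct_unit)
      (simp add: RT_unit_def tensor_basis)
next
  case (Cons T F)
  then show ?case
    by (simp add: RT_coproduct_forest_Cons coassoc_left_mult coassoc_right_mult
        del: RT_coproduct_forest.simps(3) id_apply)
qed

lemma coassoc: "tensor_assoc (tensor_map \<Delta> id (\<Delta> x)) = tensor_map id \<Delta> (\<Delta> x)"
  by (rule klinear_eqI[where s = scale and x = x])
    (auto intro!: klinear_intros simp: RT_coproduct_basis coassoc_forest simp del: id_apply)

lemma counit_left: "contract_left \<epsilon> (\<Delta> x) = x"
  by (rule klinear_eqI[where s = scale and x = x])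
    (auto intro!: klinear_intros simp: RT_coproduct_basis contract_left_forest)

lemma counit_right: "contract_right \<epsilon> (\<Delta> x) = x"
  by (rule klinear_eqI[where s = scale and x = x])
    (auto intro!: klinear_intros simp: RT_coproduct_basis contract_right_forest)

section \<open>Closure of the decorated forests under the coproduct\<close>

lemma RT_coproduct_forest_mem:
  "decorated X \<Omega> T \<Longrightarrow> \<Delta>T T \<in> free_module (RT_forests X \<Omega> \<times> RT_forests X \<Omega>)"
  "F \<in> RT_forests X \<Omega> \<Longrightarrow> \<Delta>F F \<in> free_module (RT_forests X \<Omega> \<times> RT_forests X \<Omega>)"
proof (induction T and F rule: rtree_forest_induct)
  let ?B = "RT_forests X \<Omega>"
  interpret M: kmodule_on "free_module (?B \<times> ?B)" scale
    by (rule kmodule_on_free_module)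
  have unit: "(RT_unit :: _ \<Rightarrow>\<^sub>0 'k) \<in> free_module ?B"
    unfolding RT_unit_def by (rule basis_mem) (simp add: RT_forests_def)
  {
    case (Node a F)
    have T: "basis [Node a F] \<in> free_module ?B"
      using Node.prems by (intro basis_mem) (auto simp: RT_forests_def RT_trees_def split: if_splits)
    have F: "F \<in> ?B"
      using Node.prems by (auto simp: RT_forests_def RT_trees_def)
    have "tensor_map id (RT_graft a) (\<Delta>F F) \<in> free_module (?B \<times> ?B)" if "a \<notin> X"
    proof (rule tensor_map_mem[OF _ _ Node.IH[OF F]])
      \<comment> \<open>A root outside \<open>X\<close> is decorated by \<Omega>, even when it is a
        leaf, so any decorated forest \<open>G\<close> may be grafted onto it.\<close>
      show "RT_graft a (basis G) \<in> free_module ?B" if "G \<in> ?B" for G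
        using that \<open>a \<notin> X\<close> Node.prems unfolding RT_graft_basis
        by (intro basis_mem) (auto simp: RT_forests_def RT_trees_def split: if_splits)
    qed (simp add: basis_mem)
    then show ?case
      using T basis_mem[OF F] unit by (auto intro!: M.add_mem M.scale_mem tensor_mem)
  next
    case Nil
    show ?case
      using unit by (simp add: tensor_mem)
  next
    case (Cons T F)
    then have "\<Delta>T T \<in> free_module (?B \<times> ?B)" "\<Delta>F F \<in> free_module (?B \<times> ?B)"
      by (auto simp: RT_forests_def RT_trees_def)
    then show ?case
      unfolding RT_coproduct_forest_Cons
      by (intro tensor_mult_mem RT_mult_mem basis_mem)
  }
qed

end

section \<open>Verification of the bialgebra axioms\<close>

theorem theorem3p8:
  fixes X \<Omega> :: "'a set"
    and \<mu> lam :: "'a \<Rightarrow> 'k::{comm_ring,comm_monoid_mult}"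
  assumes "\<Omega> \<noteq> {}" and "\<Omega> \<inter> X = {}"
  shows "unital_bialgebra (RT_forests X \<Omega>) RT_mult RT_unit (RT_coproduct X \<mu> lam) (RT_counit X \<mu> lam)"
proof
  let ?B = "RT_forests X \<Omega>"
  show "bilinear_on (free_module ?B) scale (free_module ?B) scale (free_module ?B) scale
      (RT_mult :: _ \<Rightarrow> _ \<Rightarrow> (_ \<Rightarrow>\<^sub>0 'k))"
    \<comment> \<open>The linearity equations are known on the whole type; closure under the product
      supplies the carrier.\<close>
    unfolding bilinear_on_def linear_on_def
    by (simp add: RT_mult_mem RT_mult_linear)
  show "(RT_unit :: _ \<Rightarrow>\<^sub>0 'k) \<in> free_module ?B"
    unfolding RT_unit_def by (rule basis_mem) (simp add: RT_forests_def)
  show "linear_on (free_module ?B) scale (free_module (?B \<times> ?B)) scale (RT_coproduct X \<mu> lam)"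
    \<comment> \<open>A linear extension lands in the carrier once its values on basis forests
      do.\<close>
    unfolding RT_coproduct_def
    by (intro kmodule_on.lin_ext_linear kmodule_on_free_module RT_coproduct_forest_mem)
  show "linear_on (free_module ?B) scale UNIV (*) (RT_counit X \<mu> lam)"
    unfolding RT_counit_def by (rule ring.lin_ext_linear) simp
qed (simp_all add: RT_mult_assoc coassoc counit_left counit_right RT_coproduct_mult RT_counit_mult
    RT_coproduct_unit RT_counit_unit)

end
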